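(* If the matrix $X$ has no zero columns, then the sequence of iterates generated by the cyclic coordinatewise minimization algorithm for $Q_{logit}$ converges.
   Context: Let $N,p\ge1$ be integers, $\lambda>0$, $y_1,\dots,y_N\in\{-1,1\}$ and $\mathbf{z}^1,\dots,\mathbf{z}^N\in\mathbb{R}^p$. Let $X$ be the $N\times p$ matrix whose $i$-th row is $(\mathbf{z}^i)^T$. For $\boldsymbol\beta\in\mathbb{R}^p$ define $$Q_{logit}(\boldsymbol\beta)=\sum_{i=1}^N\log\left(1+e^{-y_i\boldsymbol\beta^T\mathbf{z}^i}\right)+\lambda\sum_{j=1}^p|\beta_j|.$$ Cyclic coordinatewise minimization algorithm for $Q_{logit}$. Start from any $\boldsymbol\beta^0\in\mathbb{R}^p$. For $r=0,1,2,\dots$: set $\boldsymbol\beta^{r,0}=\boldsymbol\beta^r$; for $j=1,\dots,p$ let $\boldsymbol\beta^{r,j}$ be the (unique, when $X$ has no zero column) minimizer of $Q_{logit}(\boldsymbol\beta)$ over all $\boldsymbol\beta\in\mathbb{R}^p$ with $\beta_l=\beta^{r,j-1}_l$ for all $l\ne j$; set $\boldsymbol\beta^{r+1}=\boldsymbol\beta^{r,p}$. The iterates are $\{\boldsymbol\beta^r\}_{r\ge0}$ (the algorithm is run indefinitely). *)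

theory Defs
  imports "HOL-Analysis.Analysis"
begin

definition design_matrix :: "('n \<Rightarrow> real ^ 'p) \<Rightarrow> real ^ 'p ^ 'n" where
  "design_matrix z = (\<chi> i. z i)"

definition Q_logit ::
  "real \<Rightarrow> ('n::finite \<Rightarrow> real) \<Rightarrow> ('n \<Rightarrow> real ^ 'p) \<Rightarrow> real ^ ('p::finite) \<Rightarrow> real" where
  "Q_logit lam y z \<beta> =
     (\<Sum>i\<in>UNIV. ln (1 + exp (- y i * (\<beta> \<bullet> z i)))) + lam * (\<Sum>j\<in>UNIV. \<bar>\<beta> $ j\<bar>)"

text \<open>The linear order on the finite index type fixes the order of the coordinates:
  for \<open>1 \<le> j \<le> CARD('p)\<close>, \<open>coord j\<close> is the \<open>j\<close>-th smallest index.\<close>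

definition coord :: "nat \<Rightarrow> 'p::{finite,linorder}" where
  "coord j = sorted_list_of_set UNIV ! (j - 1)"

text \<open>The sequence \<open>\<beta>\<close> is a run of cyclic coordinatewise minimization of \<open>Q\<close> from the starting
  point \<open>\<beta> 0\<close>; \<open>b r j\<close> is the point reached after the \<open>j\<close>-th coordinate step of cycle \<open>r\<close>.
  Minimizers are described relationally: no selection rule is needed when they are not unique.\<close>

definition ccm_iterates ::
  "(real ^ ('p::{finite,linorder}) \<Rightarrow> real) \<Rightarrow> (nat \<Rightarrow> real ^ ('p::{finite,linorder})) \<Rightarrow> bool" where
  "ccm_iterates Q \<beta> \<longleftrightarrow>
     (\<exists>b :: nat \<Rightarrow> nat \<Rightarrow> real ^ ('p::{finite,linorder}). \<forall>r.
        b r 0 = \<beta> r \<and>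
        (\<forall>j\<in>{1..CARD('p)}.
           is_arg_min Q (\<lambda>v. \<forall>l. l \<noteq> coord j \<longrightarrow> v $ l = b r (j - 1) $ l) (b r j)) \<and>
        \<beta> (Suc r) = b r CARD('p))"

end

theory Submission
  imports Defs
begin

text \<open>
The objective has the form \<open>F \<beta> = \<phi> (X \<beta>) + lam * \<parallel>\<beta>\<parallel>\<^sub>1\<close>, where \<open>\<phi>\<close> is smooth and strongly convex on
bounded sets. As \<open>X\<close> may have a kernel, minimizers need not be unique, and
convergence of the objective values alone does not give convergence of the iterates. The proof
shows that the values converge geometrically fast; the steps are then summable.

Let \<open>d r\<close> be the length of sweep \<open>r\<close> and \<open>\<Delta> r\<close> the gap between \<open>F (\<beta> r)\<close> and the minimum. Two estimates
are combined in \<open>linear_gap_convergent\<close>.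

First, a sweep lowers \<open>F\<close> by at least a multiple of \<open>(d r)\<^sup>2\<close>, because the columns of \<open>X\<close> are
nonzero, so that \<open>F\<close> is strongly convex in every single coordinate (\<open>cyclic_sweep\<close>).

Second, eventually \<open>\<Delta> (Suc r)\<close> is at most a multiple of \<open>(d r)\<^sup>2\<close>. After a sweep \<open>F\<close> has a subgradient
of size \<open>O(d r)\<close> (\<open>nearly_stationary_subgradient\<close>), so convexity bounds the gap by
\<open>O(d r)\<close> times the distance to a minimizer, less a multiple of the squared distance of the
images. It remains to find a minimizer whose distance to the iterate is controlled by the distance of
the images. All minimizers share the image \<open>t\<close> and therefore the gradient of the smooth part, which fixes the signs
that their coordinates may have. The gradients along the iteration converge to that gradient, so the iterates
have these signs from some sweep on (\<open>subgradient_sign_stable\<close>). Among the points with these signs the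
penalty is linear and the minimizers are just the points with image \<open>t\<close>. The distance to this polyhedron is bounded
by the distance of the images, by the Hoffman-type bound \<open>conformal_preimage_bound\<close>
(\<open>nearby_minimizer\<close>).
\<close>

section \<open>Conformal preimages of bounded norm\<close>

text \<open>On the unit vectors of the cone, a compact set, the norm of \<open>f\<close> has a positive minimum; the rest
follows by homogeneity.\<close>

lemma closed_cone_norm_bound:
  fixes f :: "'a::euclidean_space \<Rightarrow> 'b::real_normed_vector"
  assumes K: "closed K" "\<And>k c. k \<in> K \<Longrightarrow> 0 \<le> c \<Longrightarrow> c *\<^sub>R k \<in> K"
    and f: "bounded_linear f"
    and ker: "\<And>k. k \<in> K \<Longrightarrow> f k = 0 \<Longrightarrow> k = 0"
  shows "\<exists>C>0. \<forall>k\<in>K. norm k \<le> C * norm (f k)"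
proof (cases "K \<inter> sphere 0 1 = {}")
  case True
  have "k = 0" if "k \<in> K" for k
  proof (rule ccontr)
    assume "k \<noteq> 0"
    then have "(1 / norm k) *\<^sub>R k \<in> K \<inter> sphere 0 1"
      using K(2)[OF that, of "1 / norm k"] by simp
    with True show False by simp
  qed
  then show ?thesis by (intro exI[of _ 1]) (metis less_numeral_extra(1) mult_1 norm_ge_zero norm_zero)
next
  case False
  interpret f: bounded_linear f by (rule f)
  have "compact (K \<inter> sphere 0 1)"
    using K(1) by (simp add: closed_Int_compact)
  moreover have "continuous_on (K \<inter> sphere 0 1) (\<lambda>k. norm (f k))"
    by (intro continuous_on_norm f.continuous_on continuous_on_id)
  ultimately obtain m where m: "m \<in> K \<inter> sphere 0 1"
    and min: "\<And>k. k \<in> K \<inter> sphere 0 1 \<Longrightarrow> norm (f m) \<le> norm (f k)"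
    using continuous_attains_inf[OF _ False] by metis
  have pos: "norm (f m) > 0" using ker[of m] m by auto
  have "norm k \<le> (1 / norm (f m)) * norm (f k)" if "k \<in> K" for k
  proof (cases "k = 0")
    case False
    then have "norm (f m) \<le> norm (f ((1 / norm k) *\<^sub>R k))"
      using K(2)[OF that, of "1 / norm k"] by (intro min) simp
    then show ?thesis using False pos by (simp add: f.scaleR field_simps)
  qed simp
  then show ?thesis using pos by (intro exI[of _ "1 / norm (f m)"]) simp
qed

text \<open>The cone of vectors that may be positive only on \<open>P\<close> and negative only on \<open>N\<close>. Indexing by
pairs of sets leaves finitely many cones, so that one constant serves all of them.\<close>

definition sign_cone :: "'p set \<times> 'p set \<Rightarrow> (real ^ 'p) set" where
  "sign_cone = (\<lambda>(P, N). {k. \<forall>j. (j \<notin> N \<longrightarrow> 0 \<le> k $ j) \<and> (j \<notin> P \<longrightarrow> k $ j \<le> 0)})"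

lemma closed_sign_cone: "closed (sign_cone s :: (real ^ 'p::finite) set)"
  unfolding sign_cone_def case_prod_beta
  by (intro closed_Collect_all closed_Collect_conj closed_Collect_imp closed_Collect_le
      continuous_intros) auto

text \<open>An instance of Hoffman's error bound for polyhedra: adding \<open>w\<close> to a point of a box
that also contains the sum with \<open>u\<close> does not leave the box. Take for \<open>w\<close> the preimage of least
\<open>\<ell>\<^sub>1\<close> norm among those that satisfy the coordinate conditions. No nonzero kernel vector can have the signs and the
support of \<open>w\<close>, since subtracting a small multiple of it would shorten \<open>w\<close>. Hence \<open>X\<close> is injective
at zero on the sign cone of \<open>w\<close> and is bounded below there; there are only finitely many cones.\<close>

lemma conformal_preimage_bound:
  fixes X :: "real ^ 'p::finite ^ 'n::finite"
  shows "\<exists>C>0. \<forall>u. \<exists>w. X *v w = X *v u \<and> (\<forall>j. 0 \<le> w $ j * u $ j \<and> \<bar>w $ j\<bar> \<le> \<bar>u $ j\<bar>)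
    \<and> norm w \<le> C * norm (X *v u)"
proof -
  define good where
    "good s \<longleftrightarrow> (\<forall>k \<in> sign_cone s. X *v k = 0 \<longrightarrow> k = 0)" for s :: "'p set \<times> 'p set"
  have "\<exists>C>0. good s \<longrightarrow> (\<forall>k \<in> sign_cone s. norm k \<le> C * norm (X *v k))" for s
  proof (cases "good s")
    case True
    then show ?thesis
      using closed_cone_norm_bound[OF closed_sign_cone, of s "(*v) X"]
      by (force simp: good_def sign_cone_def mult_nonneg_nonpos split: prod.splits)
  qed (auto intro: exI[of _ 1])
  then obtain D where D: "\<And>s. D s > 0"
    "\<And>s k. good s \<Longrightarrow> k \<in> sign_cone s \<Longrightarrow> norm k \<le> D s * norm (X *v k)"
    by metis
  define C where "C = Max (range D)"
  have CD: "D s \<le> C" for s unfolding C_def by (rule Max_ge) auto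
  have Cpos: "C > 0" using D(1) CD by (meson less_le_trans)
  have "\<exists>w. X *v w = X *v u \<and> (\<forall>j. 0 \<le> w $ j * u $ j \<and> \<bar>w $ j\<bar> \<le> \<bar>u $ j\<bar>)
      \<and> norm w \<le> C * norm (X *v u)" for u
  proof -
    define W where "W = {w. X *v w = X *v u \<and> (\<forall>j. 0 \<le> w $ j * u $ j \<and> \<bar>w $ j\<bar> \<le> \<bar>u $ j\<bar>)}"
    have "closed W" unfolding W_def
      by (intro closed_Collect_conj closed_Collect_all closed_Collect_le closed_Collect_eq
          continuous_intros matrix_vector_mult_linear_continuous_on)
    moreover have "norm w \<le> norm u" if "w \<in> W" for w
      using that by (intro norm_le_componentwise_cart) (auto simp: W_def)
    then have "bounded W" by (auto simp: bounded_iff)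
    ultimately have "compact W" by (simp add: compact_eq_bounded_closed)
    moreover have "u \<in> W" by (simp add: W_def)
    moreover have "continuous_on W (\<lambda>w. \<Sum>j\<in>UNIV. \<bar>w $ j\<bar>)" by (intro continuous_intros)
    ultimately obtain w where w: "w \<in> W"
      and min: "\<And>v. v \<in> W \<Longrightarrow> (\<Sum>j\<in>UNIV. \<bar>w $ j\<bar>) \<le> (\<Sum>j\<in>UNIV. \<bar>v $ j\<bar>)"
      using continuous_attains_inf[of W] by (metis empty_iff)
    define s where "s = ({j. w $ j > 0}, {j. w $ j < 0})"
    have "k = 0" if k: "k \<in> sign_cone s" "X *v k = 0" for k
    proof (rule ccontr)
      assume "k \<noteq> 0"
      then have ne: "{j. k $ j \<noteq> 0} \<noteq> {}" by (auto simp: vec_eq_iff)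
      \<comment> \<open>The largest multiple of \<open>k\<close> that can be subtracted from \<open>w\<close> without changing a sign.\<close>
      define e where "e = Min ((\<lambda>j. \<bar>w $ j\<bar> / \<bar>k $ j\<bar>) ` {j. k $ j \<noteq> 0})"
      have sg: "(0 \<le> k $ j \<or> w $ j < 0) \<and> (k $ j \<le> 0 \<or> w $ j > 0)" for j
        using k(1) by (auto simp: sign_cone_def s_def)
      have "w $ j \<noteq> 0" if "k $ j \<noteq> 0" for j using sg[of j] that by auto
      then have epos: "e > 0" unfolding e_def using ne by (subst Min_gr_iff) auto
      have el: "e * \<bar>k $ j\<bar> \<le> \<bar>w $ j\<bar>" for j
      proof (cases "k $ j = 0")
        case False
        then have "e \<le> \<bar>w $ j\<bar> / \<bar>k $ j\<bar>" unfolding e_def by (intro Min_le) auto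
        with False show ?thesis by (simp add: field_simps)
      qed simp
      define v where "v = w - e *\<^sub>R k"
      have shrink: "\<bar>v $ j\<bar> = \<bar>w $ j\<bar> - e * \<bar>k $ j\<bar> \<and> (0 \<le> w $ j \<longrightarrow> 0 \<le> v $ j) \<and>
          (w $ j \<le> 0 \<longrightarrow> v $ j \<le> 0)" for j
      proof (cases "w $ j > 0")
        case True
        then have "k $ j \<ge> 0" using sg[of j] by auto
        then show ?thesis using el[of j] True by (simp add: v_def)
      next
        case False
        then have "k $ j \<le> 0" using sg[of j] by auto
        then show ?thesis using el[of j] False sg[of j] by (auto simp: v_def)
      qed
      have "\<bar>v $ j\<bar> \<le> \<bar>u $ j\<bar>" for j
      proof -
        have "\<bar>w $ j\<bar> \<le> \<bar>u $ j\<bar>" using w by (simp add: W_def)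
        moreover have "0 \<le> e * \<bar>k $ j\<bar>" using epos by simp
        ultimately show ?thesis using shrink[of j] by linarith
      qed
      moreover have "0 \<le> v $ j * u $ j" for j
      proof -
        have "0 \<le> w $ j * u $ j" using w by (simp add: W_def)
        moreover have "w $ j = 0 \<Longrightarrow> v $ j = 0" using shrink[of j] by linarith
        ultimately show ?thesis using shrink[of j]
          by (cases "w $ j" "0::real" rule: linorder_cases) (auto simp: zero_le_mult_iff)
      qed
      moreover have "X *v v = X *v u"
        using w k(2)
        by (simp add: v_def W_def matrix_vector_mult_diff_distrib matrix_vector_mult_scaleR)
      ultimately have "v \<in> W" by (simp add: W_def)
      then have "(\<Sum>j\<in>UNIV. \<bar>w $ j\<bar>) \<le> (\<Sum>j\<in>UNIV. \<bar>v $ j\<bar>)" by (rule min)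
      also have "\<dots> = (\<Sum>j\<in>UNIV. \<bar>w $ j\<bar>) - e * (\<Sum>j\<in>UNIV. \<bar>k $ j\<bar>)"
        using shrink by (simp add: sum_subtractf sum_distrib_left)
      finally have "(\<Sum>j\<in>UNIV. \<bar>k $ j\<bar>) \<le> 0"
        using epos by (simp add: mult_le_0_iff)
      with norm_le_l1_cart[of k] \<open>k \<noteq> 0\<close> show False
        by (metis norm_le_zero_iff order_trans)
    qed
    then have "good s" by (simp add: good_def)
    moreover have "w \<in> sign_cone s" by (auto simp: sign_cone_def s_def)
    ultimately have "norm w \<le> D s * norm (X *v w)" by (rule D(2))
    also have "\<dots> \<le> C * norm (X *v w)" using CD by (intro mult_right_mono) auto
    finally show ?thesis using w by (auto simp: W_def)
  qed
  with Cpos show ?thesis by blast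
qed

section \<open>Geometric decrease of the gap implies convergence\<close>

text \<open>For \<open>K > 0\<close>, \<open>dec\<close> and \<open>gap\<close> make \<open>\<Delta>\<close> contract by the factor \<open>K / (c + K)\<close>. By \<open>dec\<close> the steps
are bounded by the square root of \<open>\<Delta>\<close>, hence by a geometric sequence, and the series of steps
converges.\<close>

lemma linear_gap_convergent:
  fixes x :: "nat \<Rightarrow> 'a::banach" and \<Delta> :: "nat \<Rightarrow> real"
  assumes nonneg: "\<And>r. 0 \<le> \<Delta> r"
    and c: "c > 0" and dec: "\<And>r. c * (norm (x (Suc r) - x r))\<^sup>2 \<le> \<Delta> r - \<Delta> (Suc r)"
    and gap: "\<And>r. r \<ge> R \<Longrightarrow> \<Delta> (Suc r) \<le> K * (norm (x (Suc r) - x r))\<^sup>2"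
  shows "convergent x"
proof -
  \<comment> \<open>\<open>K\<close> may be zero or negative; a larger constant serves as well.\<close>
  define K' where "K' = max K 1"
  define q where "q = K' / (c + K')"
  have K': "K' > 0" by (simp add: K'_def)
  have q: "0 < q" "q < 1" using K' c by (auto simp: q_def)
  have contract: "\<Delta> (Suc r) \<le> q * \<Delta> r" if "r \<ge> R" for r
  proof -
    have "\<Delta> (Suc r) \<le> K' * (norm (x (Suc r) - x r))\<^sup>2"
      using gap[OF that] by (rule order_trans) (auto simp: K'_def intro: mult_right_mono)
    then have "c * \<Delta> (Suc r) \<le> K' * (c * (norm (x (Suc r) - x r))\<^sup>2)"
      using c by (simp add: mult.left_commute)
    also have "\<dots> \<le> K' * (\<Delta> r - \<Delta> (Suc r))" using dec K' by (intro mult_left_mono) auto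
    finally show ?thesis using c K' by (simp add: q_def field_simps)
  qed
  have geo: "\<Delta> (R + n) \<le> q ^ n * \<Delta> R" for n
  proof (induction n)
    case (Suc n)
    have "\<Delta> (R + Suc n) \<le> q * \<Delta> (R + n)" using contract[of "R + n"] by simp
    also have "\<dots> \<le> q * (q ^ n * \<Delta> R)" using Suc q by (intro mult_left_mono) auto
    finally show ?case by simp
  qed simp
  have bound: "norm (x (Suc (n + R)) - x (n + R)) \<le> sqrt (\<Delta> R / c) * sqrt q ^ n" for n
  proof -
    have "c * (norm (x (Suc (n + R)) - x (n + R)))\<^sup>2 \<le> q ^ n * \<Delta> R"
      using dec[of "R + n"] nonneg[of "Suc (R + n)"] geo[of n] by (simp add: add.commute)
    then have "(norm (x (Suc (n + R)) - x (n + R)))\<^sup>2 \<le> \<Delta> R / c * q ^ n"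
      using c by (simp add: field_simps)
    then have "norm (x (Suc (n + R)) - x (n + R)) \<le> sqrt (\<Delta> R / c * q ^ n)"
      by (rule real_le_rsqrt)
    then show ?thesis by (simp only: real_sqrt_mult real_sqrt_power)
  qed
  have "summable (\<lambda>n. sqrt (\<Delta> R / c) * sqrt q ^ n)"
    using q by (intro summable_mult summable_geometric) simp
  then have "summable (\<lambda>n. x (Suc (n + R)) - x (n + R))"
    using bound by (rule summable_comparison_test')
  then have "summable (\<lambda>n. x (Suc n) - x n)"
    by (subst summable_iff_shift[of _ R, symmetric])
  then have "convergent (\<lambda>n. \<Sum>k<n. x (Suc k) - x k)" by (simp add: summable_iff_convergent)
  then have "convergent (\<lambda>n. x n - x 0)" by (simp add: sum_lessThan_telescope)
  then show ?thesis using convergent_add[OF _ convergent_const[of "x 0"]] by fastforce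
qed

section \<open>Stability of the sign pattern\<close>

text \<open>A nonzero \<open>x\<close> forces \<open>g\<close> to be \<open>lam\<close> or \<open>- lam\<close>. If \<open>g\<close> is close enough to \<open>v\<close>, then \<open>v\<close>, which
lies in \<open>{- lam..lam}\<close>, is that same end point.\<close>

lemma subgradient_sign_stable:
  fixes v lam :: real
  assumes v: "\<bar>v\<bar> \<le> lam" and lam: "0 < lam"
  shows "\<exists>\<epsilon>>0. \<forall>g x. \<bar>g - v\<bar> < \<epsilon> \<longrightarrow> lam * \<bar>x\<bar> = - g * x \<longrightarrow> lam * \<bar>x\<bar> = - v * x"
proof -
  define \<epsilon> where "\<epsilon> = (if \<bar>v\<bar> < lam then lam - \<bar>v\<bar> else lam)"
  have "lam * \<bar>x\<bar> = - v * x" if g: "\<bar>g - v\<bar> < \<epsilon>" "lam * \<bar>x\<bar> = - g * x" for g x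
  proof (cases x "0 :: real" rule: linorder_cases)
    case less
    then have "g = lam" using g(2) by simp
    then have "v = lam" using g(1) v by (auto simp: \<epsilon>_def split: if_splits)
    then show ?thesis using less by simp
  next
    case greater
    then have "g = - lam" using g(2) by (simp add: mult_eq_0_iff eq_neg_iff_add_eq_0 flip: distrib_right)
    then have "v = - lam" using g(1) v by (auto simp: \<epsilon>_def split: if_splits)
    then show ?thesis using greater by simp
  qed simp
  then show ?thesis using lam by (intro exI[of _ \<epsilon>]) (auto simp: \<epsilon>_def)
qed

section \<open>An l1-penalized function of a linear image\<close>

text \<open>Only these features of the logistic loss matter below. The function \<open>G\<close> is the gradient of \<open>\<phi>\<close>,
by \<open>convex\<close> and \<open>quadratic_upper_bound\<close>. Strong convexity can be asked on bounded sets
only: the logistic loss flattens out at infinity. It concerns \<open>\<phi>\<close>, not its composition with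
\<open>X\<close>, which may have a kernel; minimizers of the penalized function are then not unique.\<close>

locale l1_composite =
  fixes \<phi> :: "real ^ 'n::finite \<Rightarrow> real" and G :: "real ^ 'n \<Rightarrow> real ^ 'n"
    and X :: "real ^ 'p::finite ^ 'n" and lam L :: real
  assumes lam: "lam > 0"
    and columns: "\<And>k. column k X \<noteq> 0"
    and nonneg: "\<And>t. 0 \<le> \<phi> t"
    and strongly_convex: "\<And>M. \<exists>\<sigma>>0. \<forall>s t. norm s \<le> M \<longrightarrow> norm t \<le> M \<longrightarrow>
          \<phi> s + G s \<bullet> (t - s) + \<sigma> * (norm (t - s))\<^sup>2 \<le> \<phi> t"
    and lipschitz: "\<And>s t. norm (G s - G t) \<le> L * norm (s - t)"
begin

definition F :: "real ^ 'p \<Rightarrow> real" where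
  "F \<beta> = \<phi> (X *v \<beta>) + lam * (\<Sum>j\<in>UNIV. \<bar>\<beta> $ j\<bar>)"

definition grad :: "real ^ 'p \<Rightarrow> real ^ 'p" where
  "grad \<beta> = transpose X *v G (X *v \<beta>)"

text \<open>Optimality of the \<open>k\<close>-th coordinate: minus the partial derivative of the smooth part is a
subgradient of \<open>\<lambda>s. lam * \<bar>s\<bar>\<close> at \<open>\<beta> $ k\<close>.\<close>

definition stationary_at :: "'p \<Rightarrow> real ^ 'p \<Rightarrow> bool" where
  "stationary_at k \<beta> \<longleftrightarrow> (\<forall>s. lam * \<bar>\<beta> $ k\<bar> - grad \<beta> $ k * (s - \<beta> $ k) \<le> lam * \<bar>s\<bar>)"

lemma convex: "\<phi> s + G s \<bullet> (t - s) \<le> \<phi> t"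
proof -
  obtain \<sigma> where "\<sigma> > 0" "\<phi> s + G s \<bullet> (t - s) + \<sigma> * (norm (t - s))\<^sup>2 \<le> \<phi> t"
    using strongly_convex[of "max (norm s) (norm t)"] by auto
  then show ?thesis by (smt (verit) zero_le_mult_iff zero_le_power2)
qed

lemma quadratic_upper_bound: "\<phi> t \<le> \<phi> s + G s \<bullet> (t - s) + L * (norm (t - s))\<^sup>2"
proof -
  have "\<phi> t + G t \<bullet> (s - t) \<le> \<phi> s" by (rule convex)
  moreover have "(G t - G s) \<bullet> (t - s) \<le> norm (G t - G s) * norm (t - s)"
    by (rule norm_cauchy_schwarz)
  moreover have "\<dots> \<le> L * norm (t - s) * norm (t - s)"
    using lipschitz[of t s] by (intro mult_right_mono) auto
  ultimately show ?thesis
    by (simp add: inner_diff_left inner_diff_right power2_eq_square)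
qed

lemma grad_inner: "grad \<beta> \<bullet> w = G (X *v \<beta>) \<bullet> (X *v w)"
  unfolding grad_def by (simp add: dot_lmul_matrix transpose_matrix_vector)

lemma matrix_bound: "\<exists>B>0. \<forall>w. norm (X *v w) \<le> B * norm w"
  using bounded_linear.pos_bounded[OF matrix_vector_mul_bounded_linear[of X]]
  by (metis mult.commute)

lemma L_nonneg: "0 \<le> L"
proof -
  have "0 \<le> L * norm ((\<chi> i. 1) - (0 :: real ^ 'n))"
    by (rule order_trans[OF norm_ge_zero lipschitz])
  moreover have "(\<chi> i. 1) \<noteq> (0 :: real ^ 'n)" by (simp add: vec_eq_iff)
  ultimately show ?thesis by (simp add: zero_le_mult_iff)
qed

text \<open>Both bounds are needed: the first compares points whose images are known to approach each other
while the points are not, the second compares the stages of one sweep.\<close>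

lemma grad_lipschitz: "\<exists>K>0. \<forall>\<beta> \<gamma>. norm (grad \<beta> - grad \<gamma>) \<le> K * norm (X *v \<beta> - X *v \<gamma>)
    \<and> norm (grad \<beta> - grad \<gamma>) \<le> K * norm (\<beta> - \<gamma>)"
proof -
  obtain B where B: "B > 0" "\<And>w. norm (X *v w) \<le> B * norm w" using matrix_bound by blast
  obtain T where T: "T > 0" "\<And>w. norm (transpose X *v w) \<le> T * norm w"
    using bounded_linear.pos_bounded[OF matrix_vector_mul_bounded_linear[of "transpose X"]]
    by (metis mult.commute)
  have *: "norm (grad \<beta> - grad \<gamma>) \<le> T * (L * norm (X *v \<beta> - X *v \<gamma>))" for \<beta> \<gamma>
  proof -
    have "norm (grad \<beta> - grad \<gamma>) \<le> T * norm (G (X *v \<beta>) - G (X *v \<gamma>))"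
      unfolding grad_def matrix_vector_mult_diff_distrib[symmetric] by (rule T(2))
    also have "\<dots> \<le> T * (L * norm (X *v \<beta> - X *v \<gamma>))"
      using T(1) lipschitz by (intro mult_left_mono) auto
    finally show ?thesis .
  qed
  define K where "K = T * L + T * L * B + 1"
  have K: "T * L \<le> K" "T * L * B \<le> K" "K > 0"
    using T(1) B(1) L_nonneg by (auto simp: K_def intro!: add_nonneg_pos)
  have "norm (grad \<beta> - grad \<gamma>) \<le> K * norm (X *v \<beta> - X *v \<gamma>)" for \<beta> \<gamma>
    using *[of \<beta> \<gamma>] mult_right_mono[OF K(1), of "norm (X *v \<beta> - X *v \<gamma>)"] by simp
  moreover have "norm (grad \<beta> - grad \<gamma>) \<le> K * norm (\<beta> - \<gamma>)" for \<beta> \<gamma>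
  proof -
    have "T * L * norm (X *v (\<beta> - \<gamma>)) \<le> T * L * (B * norm (\<beta> - \<gamma>))"
      using T(1) L_nonneg B(2) by (intro mult_left_mono) auto
    then show ?thesis
      using *[of \<beta> \<gamma>] mult_right_mono[OF K(2), of "norm (\<beta> - \<gamma>)"]
      by (simp add: matrix_vector_mult_diff_distrib)
  qed
  ultimately show ?thesis using K(3) by blast
qed

lemma F_lower: "lam * norm \<beta> \<le> F \<beta>"
proof -
  have "lam * norm \<beta> \<le> lam * (\<Sum>j\<in>UNIV. \<bar>\<beta> $ j\<bar>)"
    using lam norm_le_l1_cart by (intro mult_left_mono) auto
  then show ?thesis using nonneg[of "X *v \<beta>"] by (simp add: F_def)
qed

lemma level_set_bounded: "F \<beta> \<le> c \<Longrightarrow> norm \<beta> \<le> c / lam"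
  using F_lower[of \<beta>] lam by (simp add: pos_le_divide_eq mult.commute)

lemma level_set_strongly_convex:
  "\<exists>\<sigma>>0. \<forall>\<beta> \<gamma>. F \<beta> \<le> c \<longrightarrow> F \<gamma> \<le> c \<longrightarrow>
     \<phi> (X *v \<beta>) + grad \<beta> \<bullet> (\<gamma> - \<beta>) + \<sigma> * (norm (X *v (\<gamma> - \<beta>)))\<^sup>2 \<le> \<phi> (X *v \<gamma>)"
proof -
  obtain B where B: "B > 0" "\<And>w. norm (X *v w) \<le> B * norm w" using matrix_bound by blast
  have bd: "norm (X *v \<beta>) \<le> B * (c / lam)" if "F \<beta> \<le> c" for \<beta>
    using B level_set_bounded[OF that] by (meson mult_left_mono order_trans less_imp_le)
  obtain \<sigma> where \<sigma>: "\<sigma> > 0" "\<And>s t. norm s \<le> B * (c / lam) \<Longrightarrow> norm t \<le> B * (c / lam) \<Longrightarrow>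
      \<phi> s + G s \<bullet> (t - s) + \<sigma> * (norm (t - s))\<^sup>2 \<le> \<phi> t"
    using strongly_convex by meson
  have "\<phi> (X *v \<beta>) + grad \<beta> \<bullet> (\<gamma> - \<beta>) + \<sigma> * (norm (X *v (\<gamma> - \<beta>)))\<^sup>2 \<le> \<phi> (X *v \<gamma>)"
    if "F \<beta> \<le> c" "F \<gamma> \<le> c" for \<beta> \<gamma>
    using \<sigma>(2)[OF bd[OF that(1)] bd[OF that(2)]]
    by (simp add: grad_inner matrix_vector_mult_diff_distrib)
  with \<sigma>(1) show ?thesis by blast
qed

lemma continuous_F: "continuous_on UNIV F"
proof -
  have "isCont \<phi> s" for s
  proof -
    have low: "((\<lambda>t. \<phi> s + G s \<bullet> (t - s)) \<longlongrightarrow> \<phi> s + G s \<bullet> (s - s)) (at s)"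
      by (intro tendsto_intros)
    have up: "((\<lambda>t. \<phi> s + G s \<bullet> (t - s) + L * (norm (t - s))\<^sup>2) \<longlongrightarrow>
        \<phi> s + G s \<bullet> (s - s) + L * (norm (s - s))\<^sup>2) (at s)"
      by (intro tendsto_intros)
    have "(\<phi> \<longlongrightarrow> \<phi> s) (at s)"
      by (rule tendsto_sandwich[of "\<lambda>t. \<phi> s + G s \<bullet> (t - s)" _ _
            "\<lambda>t. \<phi> s + G s \<bullet> (t - s) + L * (norm (t - s))\<^sup>2"])
        (use low up convex quadratic_upper_bound in auto)
    then show ?thesis by (simp add: isCont_def)
  qed
  then have "continuous_on UNIV \<phi>" by (simp add: continuous_at_imp_continuous_on)
  then have "continuous_on UNIV (\<phi> \<circ> (*v) X)"
    by (intro continuous_on_compose matrix_vector_mult_linear_continuous_on)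
      (auto intro: continuous_on_subset)
  then show ?thesis
    unfolding F_def[abs_def] comp_def by (intro continuous_intros)
qed

text \<open>The penalty makes sublevel sets bounded, so a minimum over the ball that contains the
sublevel set of \<open>0\<close> is a global one.\<close>

lemma minimizer_exists: "\<exists>\<beta>. \<forall>v. F \<beta> \<le> F v"
proof -
  define r where "r = F 0 / lam"
  have "0 \<le> r" using F_lower[of 0] lam by (simp add: r_def)
  then obtain \<beta> where \<beta>: "\<beta> \<in> cball 0 r" "\<And>v. v \<in> cball 0 r \<Longrightarrow> F \<beta> \<le> F v"
    using continuous_attains_inf[of "cball 0 r" F] continuous_on_subset[OF continuous_F]
    by (metis cball_eq_empty compact_cball not_less subset_UNIV)
  have "F \<beta> \<le> F v" for v
  proof (cases "F v \<le> F 0")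
    case True
    then show ?thesis using level_set_bounded[OF True] by (intro \<beta>(2)) (simp add: r_def)
  next
    case False
    have "F \<beta> \<le> F 0" using \<open>0 \<le> r\<close> by (intro \<beta>(2)) simp
    with False show ?thesis by simp
  qed
  then show ?thesis by blast
qed

lemma coordinate_shift:
  assumes "\<And>l. l \<noteq> k \<Longrightarrow> v $ l = \<beta> $ l"
  shows "v - \<beta> = (v $ k - \<beta> $ k) *\<^sub>R axis k 1"
    and "F v - F \<beta> = \<phi> (X *v v) - \<phi> (X *v \<beta>) + lam * (\<bar>v $ k\<bar> - \<bar>\<beta> $ k\<bar>)"
proof -
  show "v - \<beta> = (v $ k - \<beta> $ k) *\<^sub>R axis k 1"
    using assms by (auto simp: vec_eq_iff axis_def)
  have "(\<Sum>j\<in>UNIV. \<bar>v $ j\<bar> - \<bar>\<beta> $ j\<bar>) = (\<Sum>j\<in>UNIV. if j = k then \<bar>v $ k\<bar> - \<bar>\<beta> $ k\<bar> else 0)"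
    using assms by (intro sum.cong) auto
  then have "(\<Sum>j\<in>UNIV. \<bar>v $ j\<bar>) - (\<Sum>j\<in>UNIV. \<bar>\<beta> $ j\<bar>) = \<bar>v $ k\<bar> - \<bar>\<beta> $ k\<bar>"
    by (simp add: sum_subtractf)
  moreover have "F v - F \<beta> = \<phi> (X *v v) - \<phi> (X *v \<beta>)
      + lam * ((\<Sum>j\<in>UNIV. \<bar>v $ j\<bar>) - (\<Sum>j\<in>UNIV. \<bar>\<beta> $ j\<bar>))"
    by (simp add: F_def algebra_simps)
  ultimately show "F v - F \<beta> = \<phi> (X *v v) - \<phi> (X *v \<beta>) + lam * (\<bar>v $ k\<bar> - \<bar>\<beta> $ k\<bar>)"
    by simp
qed

text \<open>Move the \<open>k\<close>-th coordinate the fraction \<open>t\<close> of the way to \<open>s\<close>. The smooth part changes by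
\<open>t\<close> times its directional derivative plus a term of order \<open>t\<^sup>2\<close>, the penalty by at most \<open>t\<close> times
its change over the full way. Divide by \<open>t\<close> and let \<open>t\<close> tend to \<open>0\<close>.\<close>

lemma coordinate_minimizer_stationary:
  assumes min: "\<And>v. (\<And>l. l \<noteq> k \<Longrightarrow> v $ l = \<beta> $ l) \<Longrightarrow> F \<beta> \<le> F v"
  shows "stationary_at k \<beta>"
  unfolding stationary_at_def
proof
  fix s
  define \<delta> where "\<delta> = s - \<beta> $ k"
  define D where "D = grad \<beta> $ k * \<delta> + lam * (\<bar>s\<bar> - \<bar>\<beta> $ k\<bar>)"
  define u :: "real ^ 'p" where "u = \<delta> *\<^sub>R axis k 1"
  define A where "A = L * (norm (X *v u))\<^sup>2"
  have step: "0 \<le> D + t * A" if t: "0 < t" "t \<le> 1" for t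
  proof -
    define v where "v = \<beta> + t *\<^sub>R u"
    have v: "\<And>l. l \<noteq> k \<Longrightarrow> v $ l = \<beta> $ l" "v $ k = \<beta> $ k + t * \<delta>"
      by (auto simp: v_def u_def axis_def)
    have "F v - F \<beta> = \<phi> (X *v v) - \<phi> (X *v \<beta>) + lam * (\<bar>v $ k\<bar> - \<bar>\<beta> $ k\<bar>)"
      by (rule coordinate_shift(2)) (rule v(1))
    moreover have "\<phi> (X *v v) - \<phi> (X *v \<beta>) \<le> t * (grad \<beta> $ k * \<delta>) + t * (t * A)"
    proof -
      have "X *v v - X *v \<beta> = t *\<^sub>R (X *v u)"
        by (simp add: v_def matrix_vector_right_distrib matrix_vector_mult_scaleR)
      moreover have "G (X *v \<beta>) \<bullet> (X *v u) = grad \<beta> $ k * \<delta>"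
        by (simp add: u_def inner_axis flip: grad_inner)
      ultimately show ?thesis
        using quadratic_upper_bound[of "X *v v" "X *v \<beta>"] t
        by (simp add: A_def power_mult_distrib power2_eq_square mult.left_commute)
    qed
    moreover have "\<bar>v $ k\<bar> \<le> (1 - t) * \<bar>\<beta> $ k\<bar> + t * \<bar>s\<bar>"
    proof -
      have "v $ k = (1 - t) * \<beta> $ k + t * s" by (simp add: v(2) \<delta>_def algebra_simps)
      then show ?thesis
        using abs_triangle_ineq[of "(1 - t) * \<beta> $ k" "t * s"] t by (simp add: abs_mult)
    qed
    then have "lam * (\<bar>v $ k\<bar> - \<bar>\<beta> $ k\<bar>) \<le> t * (lam * (\<bar>s\<bar> - \<bar>\<beta> $ k\<bar>))"
      using mult_left_mono[of "\<bar>v $ k\<bar> - \<bar>\<beta> $ k\<bar>" "t * (\<bar>s\<bar> - \<bar>\<beta> $ k\<bar>)" lam] lam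
      by (simp add: algebra_simps)
    moreover have "F \<beta> \<le> F v" using v(1) by (intro min)
    ultimately have "0 \<le> t * (D + t * A)" by (simp add: D_def algebra_simps)
    then show ?thesis using t by (simp add: zero_le_mult_iff)
  qed
  have "((\<lambda>t. D + t * A) \<longlongrightarrow> D + 0 * A) (at_right 0)"
    by (intro tendsto_intros)
  moreover have "\<forall>\<^sub>F t in at_right 0. 0 \<le> D + t * A"
    unfolding eventually_at_right_field by (intro exI[of _ 1]) (auto intro: step)
  ultimately have "0 \<le> D"
    using tendsto_lowerbound[of "\<lambda>t. D + t * A" D "at_right 0" 0] by simp
  then show "lam * \<bar>\<beta> $ k\<bar> - grad \<beta> $ k * (s - \<beta> $ k) \<le> lam * \<bar>s\<bar>"
    by (simp add: D_def \<delta>_def algebra_simps)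
qed

lemma minimizer_stationary:
  assumes "\<And>v. F x \<le> F v"
  shows "stationary_at k x"
  using assms by (intro coordinate_minimizer_stationary) auto

text \<open>The usual description of the subgradients: the derivative equals \<open>- lam\<close> at positive, \<open>lam\<close> at negative
coordinates. The equation is the form that survives passing to convex combinations.\<close>

lemma stationary_at_sign:
  assumes "stationary_at k \<beta>"
  shows "\<bar>grad \<beta> $ k\<bar> \<le> lam" and "lam * \<bar>\<beta> $ k\<bar> = - grad \<beta> $ k * \<beta> $ k"
proof -
  let ?g = "grad \<beta> $ k" and ?x = "\<beta> $ k"
  have st: "lam * \<bar>?x\<bar> - ?g * (s - ?x) \<le> lam * \<bar>s\<bar>" for s
    using assms by (simp add: stationary_at_def)
  have "- ?g \<le> lam * (\<bar>?x + 1\<bar> - \<bar>?x\<bar>)" "?g \<le> lam * (\<bar>?x - 1\<bar> - \<bar>?x\<bar>)"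
    using st[of "?x + 1"] st[of "?x - 1"] by (simp_all add: algebra_simps)
  moreover have "lam * (\<bar>?x + 1\<bar> - \<bar>?x\<bar>) \<le> lam * 1" "lam * (\<bar>?x - 1\<bar> - \<bar>?x\<bar>) \<le> lam * 1"
    using lam by (auto intro!: mult_left_mono)
  ultimately show bd: "\<bar>?g\<bar> \<le> lam" by linarith
  have "- ?g * ?x \<le> \<bar>?g\<bar> * \<bar>?x\<bar>" by (metis abs_ge_self abs_minus_cancel abs_mult)
  also have "\<dots> \<le> lam * \<bar>?x\<bar>" using bd by (intro mult_right_mono) auto
  finally show "lam * \<bar>?x\<bar> = - ?g * ?x" using st[of 0] by simp
qed

section \<open>Decrease and near stationarity over one sweep\<close>

text \<open>After a sweep the coordinates are optimal not at one point but at stages \<open>\<gamma>\<close> of the sweep, which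
may depend on the coordinate, lie within \<open>d\<close> of the final point and share the coordinate with it.\<close>

definition nearly_stationary :: "real \<Rightarrow> real ^ 'p \<Rightarrow> bool" where
  "nearly_stationary d a \<longleftrightarrow>
     (\<forall>k. \<exists>\<gamma>. stationary_at k \<gamma> \<and> \<gamma> $ k = a $ k \<and> norm (\<gamma> - a) \<le> d)"

text \<open>A change of the \<open>k\<close>-th coordinate moves the image along the \<open>k\<close>-th column of \<open>X\<close>. As that column is not
zero, strong convexity in the image gives strong convexity in the coordinate.\<close>

lemma coordinate_step_decrease:
  "\<exists>\<kappa>>0. \<forall>k a \<beta>. F a \<le> c \<longrightarrow> F \<beta> \<le> c \<longrightarrow> (\<forall>l. l \<noteq> k \<longrightarrow> a $ l = \<beta> $ l) \<longrightarrow>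
     stationary_at k \<beta> \<longrightarrow> \<kappa> * (a $ k - \<beta> $ k)\<^sup>2 \<le> F a - F \<beta>"
proof -
  obtain \<sigma> where \<sigma>: "\<sigma> > 0" "\<And>\<beta> \<gamma>. F \<beta> \<le> c \<Longrightarrow> F \<gamma> \<le> c \<Longrightarrow>
     \<phi> (X *v \<beta>) + grad \<beta> \<bullet> (\<gamma> - \<beta>) + \<sigma> * (norm (X *v (\<gamma> - \<beta>)))\<^sup>2 \<le> \<phi> (X *v \<gamma>)"
    using level_set_strongly_convex by meson
  define \<mu> where "\<mu> = Min (range (\<lambda>k. (norm (column k X))\<^sup>2))"
  have \<mu>: "\<mu> > 0" unfolding \<mu>_def using columns by (subst Min_gr_iff) auto
  have \<mu>_le: "\<mu> \<le> (norm (column k X))\<^sup>2" for k unfolding \<mu>_def by (intro Min_le) auto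
  have "\<sigma> * \<mu> * (a $ k - \<beta> $ k)\<^sup>2 \<le> F a - F \<beta>"
    if F: "F a \<le> c" "F \<beta> \<le> c" and eq: "\<And>l. l \<noteq> k \<Longrightarrow> a $ l = \<beta> $ l"
      and st: "stationary_at k \<beta>" for k a \<beta>
  proof -
    let ?d = "a $ k - \<beta> $ k"
    note sh = coordinate_shift[OF eq]
    have "norm (X *v (a - \<beta>)) = \<bar>?d\<bar> * norm (column k X)"
      by (subst sh(1)) (simp_all add: matrix_vector_mult_scaleR matrix_vector_mult_basis)
    then have "(norm (X *v (a - \<beta>)))\<^sup>2 = ?d\<^sup>2 * (norm (column k X))\<^sup>2"
      by (simp add: power_mult_distrib)
    moreover have "?d\<^sup>2 * \<mu> \<le> ?d\<^sup>2 * (norm (column k X))\<^sup>2"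
      using \<mu>_le by (intro mult_left_mono) auto
    ultimately have "\<sigma> * \<mu> * ?d\<^sup>2 \<le> \<sigma> * (norm (X *v (a - \<beta>)))\<^sup>2"
      using \<sigma>(1) by (simp add: mult.commute mult.left_commute)
    moreover have "grad \<beta> \<bullet> (a - \<beta>) = grad \<beta> $ k * ?d"
      by (subst sh(1)) (simp_all add: inner_axis mult.commute)
    moreover have "F a - F \<beta> = \<phi> (X *v a) - \<phi> (X *v \<beta>) + lam * (\<bar>a $ k\<bar> - \<bar>\<beta> $ k\<bar>)"
      by (rule sh(2))
    moreover have "lam * \<bar>\<beta> $ k\<bar> - grad \<beta> $ k * ?d \<le> lam * \<bar>a $ k\<bar>"
      using st by (simp add: stationary_at_def)
    ultimately show ?thesis using \<sigma>(2)[OF F(2,1)] by (simp add: right_diff_distrib)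
  qed
  then show ?thesis using \<sigma>(1) \<mu> by (intro exI[of _ "\<sigma> * \<mu>"]) auto
qed

text \<open>Every coordinate moves once in a sweep. Hence each stage agrees with the result of the sweep
on the coordinates already treated and with its start on the others, so that the distances between
stages are at most the length of the sweep, and the squares of the single steps add up to
the square of that length. The stage right after the step in coordinate \<open>k\<close> witnesses
\<open>nearly_stationary\<close> for \<open>k\<close>.\<close>

lemma cyclic_sweep:
  "\<exists>\<kappa>>0. \<forall>(e :: nat \<Rightarrow> 'p) m b. bij_betw e {1..m} UNIV \<longrightarrow> F (b 0) \<le> c \<longrightarrow>
     (\<forall>j\<in>{1..m}. is_arg_min F (\<lambda>v. \<forall>l. l \<noteq> e j \<longrightarrow> v $ l = b (j - 1) $ l) (b j)) \<longrightarrow>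
     \<kappa> * (norm (b m - b 0))\<^sup>2 \<le> F (b 0) - F (b m) \<and> nearly_stationary (norm (b m - b 0)) (b m)"
proof -
  obtain \<kappa> where \<kappa>: "\<kappa> > 0" "\<And>k a \<beta>. F a \<le> c \<Longrightarrow> F \<beta> \<le> c \<Longrightarrow>
      (\<And>l. l \<noteq> k \<Longrightarrow> a $ l = \<beta> $ l) \<Longrightarrow> stationary_at k \<beta> \<Longrightarrow>
      \<kappa> * (a $ k - \<beta> $ k)\<^sup>2 \<le> F a - F \<beta>"
    using coordinate_step_decrease by meson
  have "\<kappa> * (norm (b m - b 0))\<^sup>2 \<le> F (b 0) - F (b m)
      \<and> nearly_stationary (norm (b m - b 0)) (b m)"
    if e: "bij_betw e {1..m} UNIV" and c: "F (b 0) \<le> c"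
      and b: "\<And>j. j \<in> {1..m} \<Longrightarrow> is_arg_min F (\<lambda>v. \<forall>l. l \<noteq> e j \<longrightarrow> v $ l = b (j - 1) $ l) (b j)"
    for e :: "nat \<Rightarrow> 'p" and m b
  proof -
    have stay: "b (Suc i) $ l = b i $ l" if "i < m" "l \<noteq> e (Suc i)" for i l
      using b[of "Suc i"] that by (auto simp: is_arg_min_def)
    have Fmin: "F (b (Suc i)) \<le> F v" if "i < m" "\<And>l. l \<noteq> e (Suc i) \<Longrightarrow> v $ l = b i $ l" for i v
      using b[of "Suc i"] that by (auto simp: is_arg_min_def not_less)
    have stat: "stationary_at (e (Suc i)) (b (Suc i))" if "i < m" for i
      using that by (intro coordinate_minimizer_stationary Fmin) (auto simp: stay)
    have keep: "b j $ l = b i $ l" if "i \<le> j" "j \<le> m" "l \<notin> e ` {i<..j}" for i j l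
      using that
    proof (induction j rule: dec_induct)
      case (step n)
      then have "b (Suc n) $ l = b n $ l" "b n $ l = b i $ l"
        using stay[of n l] by (auto simp: image_iff)
      then show ?case by simp
    qed simp
    have onto: "\<exists>j\<in>{1..m}. k = e j" for k
      using bij_betw_imp_surj_on[OF e] by (metis UNIV_I imageE)
    have sep: "e j \<notin> e ` A" if "j \<in> {1..m}" "A \<subseteq> {1..m}" "j \<notin> A" for j A
      using inj_on_image_mem_iff[OF bij_betw_imp_inj_on[OF e]] that by blast
    have before: "b i $ e j = b 0 $ e j" if "i < j" "j \<le> m" for i j
      using that by (intro keep sep) auto
    have after: "b i $ e j = b m $ e j" if "1 \<le> j" "j \<le> i" "i \<le> m" for i j
      using that by (intro keep[symmetric] sep) auto
    have dec: "F (b i) \<le> c \<and>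
        \<kappa> * (\<Sum>j\<in>{1..i}. ((b m - b 0) $ e j)\<^sup>2) \<le> F (b 0) - F (b i)" if "i \<le> m" for i
      using that
    proof (induction i)
      case (Suc i)
      then have IH: "F (b i) \<le> c"
        "\<kappa> * (\<Sum>j\<in>{1..i}. ((b m - b 0) $ e j)\<^sup>2) \<le> F (b 0) - F (b i)" by auto
      have "F (b (Suc i)) \<le> F (b i)" using Suc.prems by (intro Fmin) auto
      moreover have "\<kappa> * (b i $ e (Suc i) - b (Suc i) $ e (Suc i))\<^sup>2 \<le> F (b i) - F (b (Suc i))"
        using Suc.prems stay IH calculation by (intro \<kappa>(2) stat) auto
      moreover have "(b i $ e (Suc i) - b (Suc i) $ e (Suc i))\<^sup>2 = ((b m - b 0) $ e (Suc i))\<^sup>2"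
        using before[of i "Suc i"] after[of "Suc i" "Suc i"] Suc.prems
        by (simp add: power2_commute)
      ultimately show ?case using IH by (simp add: distrib_left)
    qed (use c in simp)
    have "(norm (b m - b 0))\<^sup>2 = (\<Sum>k\<in>UNIV. ((b m - b 0) $ k)\<^sup>2)"
      unfolding power2_norm_eq_inner by (simp add: inner_vec_def power2_eq_square)
    also have "\<dots> = (\<Sum>j\<in>{1..m}. ((b m - b 0) $ e j)\<^sup>2)"
      by (rule sum.reindex_bij_betw[OF e, symmetric])
    finally have "\<kappa> * (norm (b m - b 0))\<^sup>2 \<le> F (b 0) - F (b m)" using dec[of m] by simp
    moreover have "nearly_stationary (norm (b m - b 0)) (b m)"
      unfolding nearly_stationary_def
    proof
      fix k
      obtain j where j: "j \<in> {1..m}" "k = e j" using onto by blast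
      have "stationary_at k (b j)" using stat[of "j - 1"] j by auto
      moreover have "b j $ k = b m $ k" using after[of j j] j by simp
      moreover have "norm (b j - b m) \<le> norm (b m - b 0)"
      proof (rule norm_le_componentwise_cart)
        fix l
        obtain i where "i \<in> {1..m}" "l = e i" using onto by blast
        then show "norm ((b j - b m) $ l) \<le> norm ((b m - b 0) $ l)"
          using before[of j i] after[of i j] j(1) by (cases "i \<le> j") auto
      qed
      ultimately show "\<exists>\<gamma>. stationary_at k \<gamma> \<and> \<gamma> $ k = b m $ k \<and>
          norm (\<gamma> - b m) \<le> norm (b m - b 0)" by blast
    qed
    ultimately show ?thesis by blast
  qed
  with \<kappa>(1) show ?thesis by blast
qed

text \<open>Replacing the partial derivatives at the stages by those at \<open>a\<close> costs at most a Lipschitz constant times \<open>d\<close>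
in each coordinate. These errors form a subgradient \<open>\<xi>\<close> of the whole function at \<open>a\<close>, and strong convexity
in the image adds the quadratic term.\<close>

lemma nearly_stationary_subgradient:
  "\<exists>K>0. \<exists>\<sigma>>0. \<forall>a d. nearly_stationary d a \<longrightarrow> F a \<le> c \<longrightarrow>
     (\<exists>\<xi>. norm \<xi> \<le> K * d \<and>
       (\<forall>v. F v \<le> c \<longrightarrow> F a + \<xi> \<bullet> (v - a) + \<sigma> * (norm (X *v (v - a)))\<^sup>2 \<le> F v))"
proof -
  obtain \<sigma> where \<sigma>: "\<sigma> > 0" "\<And>\<beta> \<gamma>. F \<beta> \<le> c \<Longrightarrow> F \<gamma> \<le> c \<Longrightarrow>
     \<phi> (X *v \<beta>) + grad \<beta> \<bullet> (\<gamma> - \<beta>) + \<sigma> * (norm (X *v (\<gamma> - \<beta>)))\<^sup>2 \<le> \<phi> (X *v \<gamma>)"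
    using level_set_strongly_convex by meson
  obtain K where K: "K > 0" "\<And>\<beta> \<gamma>. norm (grad \<beta> - grad \<gamma>) \<le> K * norm (\<beta> - \<gamma>)"
    using grad_lipschitz by blast
  have "\<exists>\<xi>. norm \<xi> \<le> (CARD('p) * K) * d \<and>
       (\<forall>v. F v \<le> c \<longrightarrow> F a + \<xi> \<bullet> (v - a) + \<sigma> * (norm (X *v (v - a)))\<^sup>2 \<le> F v)"
    if near: "nearly_stationary d a" and Fa: "F a \<le> c" for a d
  proof -
    obtain \<gamma> where \<gamma>: "\<And>k. stationary_at k (\<gamma> k)" "\<And>k. \<gamma> k $ k = a $ k"
      "\<And>k. norm (\<gamma> k - a) \<le> d"
      using near unfolding nearly_stationary_def by metis
    define \<xi> where "\<xi> = (\<chi> k. grad a $ k - grad (\<gamma> k) $ k)"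
    have "\<bar>\<xi> $ k\<bar> \<le> K * d" for k
    proof -
      have "\<bar>\<xi> $ k\<bar> \<le> norm (grad a - grad (\<gamma> k))"
        using component_le_norm_cart[of "grad a - grad (\<gamma> k)" k] by (simp add: \<xi>_def)
      also have "\<dots> \<le> K * norm (a - \<gamma> k)" by (rule K(2))
      also have "\<dots> \<le> K * d" using K(1) \<gamma>(3)[of k] by (simp add: norm_minus_commute)
      finally show ?thesis .
    qed
    then have "(\<Sum>k\<in>UNIV. \<bar>\<xi> $ k\<bar>) \<le> of_nat CARD('p) * (K * d)" by (intro sum_bounded_above)
    then have "norm \<xi> \<le> (CARD('p) * K) * d" using norm_le_l1_cart[of \<xi>] by simp
    moreover have "F a + \<xi> \<bullet> (v - a) + \<sigma> * (norm (X *v (v - a)))\<^sup>2 \<le> F v" if "F v \<le> c" for v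
    proof -
      have "lam * \<bar>a $ k\<bar> + (\<xi> - grad a) $ k * (v - a) $ k \<le> lam * \<bar>v $ k\<bar>" for k
        using \<gamma>(1)[of k] \<gamma>(2)[of k] by (simp add: stationary_at_def \<xi>_def)
      then have "(\<Sum>k\<in>UNIV. lam * \<bar>a $ k\<bar> + (\<xi> - grad a) $ k * (v - a) $ k)
          \<le> (\<Sum>k\<in>UNIV. lam * \<bar>v $ k\<bar>)"
        by (intro sum_mono)
      then have "lam * (\<Sum>k\<in>UNIV. \<bar>a $ k\<bar>) + (\<xi> - grad a) \<bullet> (v - a)
          \<le> lam * (\<Sum>k\<in>UNIV. \<bar>v $ k\<bar>)"
        by (simp add: sum.distrib sum_distrib_left inner_vec_def)
      then show ?thesis using \<sigma>(2)[OF Fa that] by (simp add: F_def inner_diff_left)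
    qed
    ultimately show ?thesis by blast
  qed
  moreover have "CARD('p) * K > 0" using K(1) by simp
  ultimately show ?thesis using \<sigma>(1) by blast
qed

section \<open>Convergence of the sweeps\<close>

text \<open>The hypothesis says that the coordinates of \<open>a\<close> have the signs that the gradient at the minimizer \<open>x\<close>
allows. The point \<open>x\<close> satisfies the same equations, hence so do all points that lie between \<open>a\<close> and \<open>x\<close> in each
coordinate. Among them is a \<open>v\<close> with the image of \<open>x\<close> whose distance from \<open>a\<close> is controlled by the
images, by \<open>conformal_preimage_bound\<close>. For such \<open>v\<close> the penalty is \<open>- (grad x \<bullet> v)\<close>,
which depends on the image of \<open>v\<close> only and so equals the penalty of \<open>x\<close>.\<close>

lemma nearby_minimizer:
  assumes x: "\<And>v. F x \<le> F v"
  shows "\<exists>C>0. \<forall>a. (\<forall>k. lam * \<bar>a $ k\<bar> = - grad x $ k * a $ k) \<longrightarrow>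
    (\<exists>v. F v \<le> F x \<and> X *v v = X *v x \<and> norm (v - a) \<le> C * norm (X *v (v - a)))"
proof -
  obtain C where C: "C > 0" "\<And>u. \<exists>w. X *v w = X *v u \<and>
      (\<forall>j. 0 \<le> w $ j * u $ j \<and> \<bar>w $ j\<bar> \<le> \<bar>u $ j\<bar>) \<and> norm w \<le> C * norm (X *v u)"
    using conformal_preimage_bound[of X] by blast
  have "\<exists>v. F v \<le> F x \<and> X *v v = X *v x \<and> norm (v - a) \<le> C * norm (X *v (v - a))"
    if a: "\<And>k. lam * \<bar>a $ k\<bar> = - grad x $ k * a $ k" for a
  proof -
    obtain w where w: "X *v w = X *v (x - a)"
      "\<And>j. 0 \<le> w $ j * (x - a) $ j" "\<And>j. \<bar>w $ j\<bar> \<le> \<bar>(x - a) $ j\<bar>"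
      "norm w \<le> C * norm (X *v (x - a))"
      using C(2) by meson
    define v where "v = a + w"
    have Xv: "X *v v = X *v x"
      using w(1) by (simp add: v_def matrix_vector_right_distrib matrix_vector_mult_diff_distrib)
    have "lam * \<bar>v $ k\<bar> \<le> - grad x $ k * v $ k" for k
    proof -
      have "\<exists>t. 0 \<le> t \<and> t \<le> 1 \<and> w $ k = t * (x - a) $ k"
      proof (cases "(x - a) $ k = 0")
        case True
        then show ?thesis using w(3)[of k] by (intro exI[of _ 0]) simp
      next
        case False
        then show ?thesis using w(2,3)[of k]
          by (intro exI[of _ "w $ k / (x - a) $ k"])
            (auto simp: divide_le_eq zero_le_divide_iff zero_le_mult_iff)
      qed
      then obtain t where t: "0 \<le> t" "t \<le> 1" "v $ k = (1 - t) * a $ k + t * x $ k"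
        by (auto simp: v_def algebra_simps)
      have "lam * \<bar>v $ k\<bar> \<le> lam * ((1 - t) * \<bar>a $ k\<bar> + t * \<bar>x $ k\<bar>)"
        using abs_triangle_ineq[of "(1 - t) * a $ k" "t * x $ k"] t lam by (simp add: abs_mult)
      also have "\<dots> = (1 - t) * (lam * \<bar>a $ k\<bar>) + t * (lam * \<bar>x $ k\<bar>)"
        by (simp add: algebra_simps)
      also have "\<dots> = - grad x $ k * v $ k"
        unfolding a stationary_at_sign(2)[OF minimizer_stationary[OF x]]
        by (simp add: t(3) algebra_simps)
      finally show ?thesis .
    qed
    then have "(\<Sum>k\<in>UNIV. lam * \<bar>v $ k\<bar>) \<le> (\<Sum>k\<in>UNIV. - grad x $ k * v $ k)"
      by (rule sum_mono)
    also have "\<dots> = - (grad x \<bullet> v)" by (simp add: inner_vec_def sum_negf)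
    also have "\<dots> = - (grad x \<bullet> x)" by (simp add: grad_inner Xv)
    also have "\<dots> = (\<Sum>k\<in>UNIV. lam * \<bar>x $ k\<bar>)"
      unfolding stationary_at_sign(2)[OF minimizer_stationary[OF x]]
      by (simp add: inner_vec_def sum_negf)
    finally have "F v \<le> F x" by (simp add: F_def Xv sum_distrib_left)
    moreover have "norm (v - a) \<le> C * norm (X *v (v - a))" using w by (simp add: v_def)
    ultimately show ?thesis using Xv by blast
  qed
  with C(1) show ?thesis by blast
qed

text \<open>The growth estimate from \<open>nearly_stationary_subgradient\<close> is used twice. Applied to a fixed minimizer \<open>x\<close>, it
shows that the images of the iterates converge to the image of \<open>x\<close>. So do the gradients, and
eventually the iterates have the signs that \<open>nearby_minimizer\<close> asks for. Applied to the minimizer \<open>v\<close>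
supplied there, whose distance to the iterate is at most \<open>C\<close> times the distance \<open>s\<close> of the images, it
bounds the gap by \<open>K * d r * C * s - \<sigma> * s\<^sup>2\<close>, which is at most a multiple of \<open>(d r)\<^sup>2\<close>
whatever \<open>s\<close> is. With the decrease per sweep this is geometric convergence.\<close>

lemma sweeps_converge:
  fixes \<beta> :: "nat \<Rightarrow> real ^ 'p"
  assumes \<kappa>: "\<kappa> > 0"
    and dec: "\<And>r. \<kappa> * (norm (\<beta> (Suc r) - \<beta> r))\<^sup>2 \<le> F (\<beta> r) - F (\<beta> (Suc r))"
    and near: "\<And>r. nearly_stationary (norm (\<beta> (Suc r) - \<beta> r)) (\<beta> (Suc r))"
  shows "convergent \<beta>"
proof -
  obtain x where x: "\<And>v. F x \<le> F v" using minimizer_exists by blast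
  define c where "c = F (\<beta> 0)"
  define d where "d r = norm (\<beta> (Suc r) - \<beta> r)" for r
  define q where "q r = norm (X *v (x - \<beta> (Suc r)))" for r
  have "decseq (\<lambda>r. F (\<beta> r))"
  proof (rule decseq_SucI)
    fix r
    have "0 \<le> \<kappa> * (norm (\<beta> (Suc r) - \<beta> r))\<^sup>2" using \<kappa> by simp
    with dec[of r] show "F (\<beta> (Suc r)) \<le> F (\<beta> r)" by linarith
  qed
  then have level: "F (\<beta> r) \<le> c" for r unfolding c_def by (rule decseqD) simp
  have Fx: "F x \<le> c" unfolding c_def by (rule x)
  obtain K \<sigma> where K: "K > 0" and \<sigma>: "\<sigma> > 0"
    and sub: "\<And>a d. nearly_stationary d a \<Longrightarrow> F a \<le> c \<Longrightarrow> \<exists>\<xi>. norm \<xi> \<le> K * d \<and>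
       (\<forall>v. F v \<le> c \<longrightarrow> F a + \<xi> \<bullet> (v - a) + \<sigma> * (norm (X *v (v - a)))\<^sup>2 \<le> F v)"
    using nearly_stationary_subgradient[of c] by metis
  have growth: "F (\<beta> (Suc r)) + \<sigma> * (norm (X *v (v - \<beta> (Suc r))))\<^sup>2
      \<le> F v + K * d r * norm (v - \<beta> (Suc r))" if v: "F v \<le> c" for r v
  proof -
    obtain \<xi> where \<xi>: "norm \<xi> \<le> K * d r"
      "F (\<beta> (Suc r)) + \<xi> \<bullet> (v - \<beta> (Suc r)) + \<sigma> * (norm (X *v (v - \<beta> (Suc r))))\<^sup>2 \<le> F v"
      using sub[OF near level] v unfolding d_def by blast
    have "- (\<xi> \<bullet> (v - \<beta> (Suc r))) \<le> norm \<xi> * norm (v - \<beta> (Suc r))"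
      using norm_cauchy_schwarz[of "- \<xi>" "v - \<beta> (Suc r)"] by simp
    also have "\<dots> \<le> K * d r * norm (v - \<beta> (Suc r))" using \<xi>(1) by (intro mult_right_mono) auto
    finally show ?thesis using \<xi>(2) by linarith
  qed
  \<comment> \<open>The decreasing values converge, so the decrease per sweep tends to zero.\<close>
  have d0: "d \<longlonglongrightarrow> 0"
  proof -
    obtain l where "(\<lambda>r. F (\<beta> r)) \<longlonglongrightarrow> l"
      using decseq_convergent[OF \<open>decseq (\<lambda>r. F (\<beta> r))\<close>, of "F x"] x by blast
    then have "(\<lambda>r. (F (\<beta> r) - F (\<beta> (Suc r))) / \<kappa>) \<longlonglongrightarrow> (l - l) / \<kappa>"
      using \<kappa> by (intro tendsto_intros LIMSEQ_Suc) auto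
    then have lim: "(\<lambda>r. (F (\<beta> r) - F (\<beta> (Suc r))) / \<kappa>) \<longlonglongrightarrow> 0" by simp
    have "(\<lambda>r. (d r)\<^sup>2) \<longlonglongrightarrow> 0"
      by (rule tendsto_sandwich[OF _ _ tendsto_const lim])
        (use dec \<kappa> in \<open>auto simp: d_def pos_le_divide_eq mult.commute\<close>)
    then have "(\<lambda>r. sqrt ((d r)\<^sup>2)) \<longlonglongrightarrow> sqrt 0" by (rule tendsto_real_sqrt)
    then show ?thesis by (simp add: d_def[abs_def])
  qed
  have q0: "q \<longlonglongrightarrow> 0"
  proof -
    have upper: "(q r)\<^sup>2 \<le> K * d r * (2 * c / lam) / \<sigma>" for r
    proof -
      have "norm (x - \<beta> (Suc r)) \<le> 2 * c / lam"
        using norm_triangle_ineq4[of x "\<beta> (Suc r)"] level_set_bounded[OF Fx]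
          level_set_bounded[OF level[of "Suc r"]] by simp
      then have "K * d r * norm (x - \<beta> (Suc r)) \<le> K * d r * (2 * c / lam)"
        using K by (intro mult_left_mono) (auto simp: d_def)
      then have "\<sigma> * (q r)\<^sup>2 \<le> K * d r * (2 * c / lam)"
        using growth[OF Fx, of r] x[of "\<beta> (Suc r)"] unfolding q_def by linarith
      then show ?thesis using \<sigma> by (subst pos_le_divide_eq) (simp_all only: mult.commute)
    qed
    have "(\<lambda>r. K * d r * (2 * c / lam) / \<sigma>) \<longlonglongrightarrow> K * 0 * (2 * c / lam) / \<sigma>"
      using d0 \<sigma> by (intro tendsto_intros) auto
    then have lim: "(\<lambda>r. K * d r * (2 * c / lam) / \<sigma>) \<longlonglongrightarrow> 0" by simp
    have "(\<lambda>r. (q r)\<^sup>2) \<longlonglongrightarrow> 0"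
      by (rule tendsto_sandwich[OF _ _ tendsto_const lim]) (intro always_eventually allI upper zero_le_power2)+
    then have "(\<lambda>r. sqrt ((q r)\<^sup>2)) \<longlonglongrightarrow> sqrt 0" by (rule tendsto_real_sqrt)
    then show ?thesis by (simp add: q_def[abs_def])
  qed
  obtain K' where K': "K' > 0" "\<And>\<beta> \<gamma>. norm (grad \<beta> - grad \<gamma>) \<le> K' * norm (X *v \<beta> - X *v \<gamma>)"
    "\<And>\<beta> \<gamma>. norm (grad \<beta> - grad \<gamma>) \<le> K' * norm (\<beta> - \<gamma>)"
    using grad_lipschitz by blast
  have identify: "\<forall>\<^sub>F r in sequentially. lam * \<bar>\<beta> (Suc r) $ k\<bar> = - grad x $ k * \<beta> (Suc r) $ k" for k
  proof -
    obtain \<epsilon> where \<epsilon>: "\<epsilon> > 0" "\<And>g s. \<bar>g - grad x $ k\<bar> < \<epsilon> \<Longrightarrow> lam * \<bar>s\<bar> = - g * s \<Longrightarrow>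
        lam * \<bar>s\<bar> = - grad x $ k * s"
      using subgradient_sign_stable[OF stationary_at_sign(1)[OF minimizer_stationary[OF x]] lam]
      by metis
    have "(\<lambda>r. K' * d r + K' * q r) \<longlonglongrightarrow> K' * 0 + K' * 0"
      using d0 q0 by (intro tendsto_intros)
    then have "\<forall>\<^sub>F r in sequentially. K' * d r + K' * q r < \<epsilon>"
      using \<epsilon>(1) by (auto dest: order_tendstoD(2))
    then show ?thesis
    proof eventually_elim
      case (elim r)
      obtain \<gamma> where \<gamma>: "stationary_at k \<gamma>" "\<gamma> $ k = \<beta> (Suc r) $ k"
        "norm (\<gamma> - \<beta> (Suc r)) \<le> d r"
        using near[of r] unfolding nearly_stationary_def d_def by blast
      have "\<bar>grad \<gamma> $ k - grad x $ k\<bar> \<le> norm (grad \<gamma> - grad x)"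
        using component_le_norm_cart[of "grad \<gamma> - grad x" k] by simp
      also have "\<dots> \<le> norm (grad \<gamma> - grad (\<beta> (Suc r))) + norm (grad (\<beta> (Suc r)) - grad x)"
        using norm_triangle_ineq[of "grad \<gamma> - grad (\<beta> (Suc r))" "grad (\<beta> (Suc r)) - grad x"] by simp
      also have "norm (grad \<gamma> - grad (\<beta> (Suc r))) \<le> K' * d r"
        by (rule order_trans[OF K'(3)]) (use K'(1) \<gamma>(3) in \<open>intro mult_left_mono; simp\<close>)
      also have "norm (grad (\<beta> (Suc r)) - grad x) \<le> K' * q r"
        using K'(2)[of "\<beta> (Suc r)" x]
        by (simp add: q_def matrix_vector_mult_diff_distrib norm_minus_commute)
      finally have "\<bar>grad \<gamma> $ k - grad x $ k\<bar> < \<epsilon>" using elim by simp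
      then show ?case using \<epsilon>(2) stationary_at_sign(2)[OF \<gamma>(1)] \<gamma>(2) by metis
    qed
  qed
  then have "\<forall>\<^sub>F r in sequentially. \<forall>k. lam * \<bar>\<beta> (Suc r) $ k\<bar> = - grad x $ k * \<beta> (Suc r) $ k"
    by (simp add: eventually_all_finite)
  then obtain R where R: "\<And>r k. r \<ge> R \<Longrightarrow> lam * \<bar>\<beta> (Suc r) $ k\<bar> = - grad x $ k * \<beta> (Suc r) $ k"
    unfolding eventually_sequentially by blast
  obtain C where C: "C > 0" "\<And>a. (\<And>k. lam * \<bar>a $ k\<bar> = - grad x $ k * a $ k) \<Longrightarrow>
      \<exists>v. F v \<le> F x \<and> X *v v = X *v x \<and> norm (v - a) \<le> C * norm (X *v (v - a))"
    using nearby_minimizer[OF x] by blast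
  have gap: "F (\<beta> (Suc r)) - F x \<le> ((K * C)\<^sup>2 / (4 * \<sigma>)) * (norm (\<beta> (Suc r) - \<beta> r))\<^sup>2"
    if r: "r \<ge> R" for r
  proof -
    obtain v where v: "F v \<le> F x" "norm (v - \<beta> (Suc r)) \<le> C * norm (X *v (v - \<beta> (Suc r)))"
      using C(2)[OF R[OF r]] by blast
    define s where "s = norm (X *v (v - \<beta> (Suc r)))"
    have "K * d r * norm (v - \<beta> (Suc r)) \<le> K * d r * (C * s)"
      using v(2) K by (intro mult_left_mono) (auto simp: s_def d_def)
    moreover have "F (\<beta> (Suc r)) + \<sigma> * s\<^sup>2 \<le> F v + K * d r * norm (v - \<beta> (Suc r))"
      unfolding s_def using v(1) Fx by (intro growth) simp
    ultimately have "F (\<beta> (Suc r)) - F x \<le> (K * C * d r) * s - \<sigma> * s\<^sup>2"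
      using v(1) by (simp add: mult.commute mult.left_commute)
    also have "\<dots> \<le> (K * C * d r)\<^sup>2 / (4 * \<sigma>)"
    proof -
      \<comment> \<open>Complete the square in \<open>s\<close>.\<close>
      have "p * s - \<sigma> * s\<^sup>2 \<le> p\<^sup>2 / (4 * \<sigma>)" for p
      proof -
        have "p\<^sup>2 - (p * s - \<sigma> * s\<^sup>2) * (4 * \<sigma>) = (p - 2 * \<sigma> * s)\<^sup>2"
          by (simp add: power2_eq_square algebra_simps)
        then have "(p * s - \<sigma> * s\<^sup>2) * (4 * \<sigma>) \<le> p\<^sup>2"
          using zero_le_power2[of "p - 2 * \<sigma> * s"] by linarith
        then show ?thesis using \<sigma> by (subst pos_le_divide_eq) auto
      qed
      then show ?thesis .
    qed
    finally show ?thesis by (simp add: d_def power_mult_distrib)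
  qed
  show ?thesis
    by (rule linear_gap_convergent[where \<Delta> = "\<lambda>r. F (\<beta> r) - F x", OF _ \<kappa> _ gap])
      (use x dec in auto)
qed

end

section \<open>The logistic loss\<close>

definition logistic_loss :: "real \<Rightarrow> real \<Rightarrow> real" where
  "logistic_loss y t = ln (1 + exp (- y * t))"

definition logistic_slope :: "real \<Rightarrow> real \<Rightarrow> real" where
  "logistic_slope y t = - y / (1 + exp (y * t))"

definition logistic_curvature :: "real \<Rightarrow> real \<Rightarrow> real" where
  "logistic_curvature y t = y\<^sup>2 * exp (y * t) / (1 + exp (y * t))\<^sup>2"

lemma one_plus_exp_pos: "0 < 1 + exp (t :: real)" "1 + exp t \<noteq> 0"
  using exp_gt_zero[of t] by linarith+

lemma logistic_loss_deriv:
  "(logistic_loss y has_real_derivative logistic_slope y t) (at t)"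
proof -
  have "- y * exp (- y * t) / (1 + exp (- y * t)) = - y / (1 + exp (y * t))"
    using one_plus_exp_pos(2) by (simp add: frac_eq_eq distrib_left flip: exp_add)
  then show ?thesis
    unfolding logistic_loss_def[abs_def] logistic_slope_def
    by (auto intro!: derivative_eq_intros simp: one_plus_exp_pos mult.commute)
qed

lemma logistic_slope_deriv:
  "(logistic_slope y has_real_derivative logistic_curvature y t) (at t)"
  unfolding logistic_slope_def[abs_def] logistic_curvature_def
  by (auto intro!: derivative_eq_intros simp: one_plus_exp_pos power2_eq_square)

text \<open>As \<open>y\<^sup>2 = 1\<close>, the curvature is \<open>e / (1 + e)\<^sup>2\<close> with \<open>e = exp (y * t)\<close>, hence at most \<open>1\<close>.\<close>

lemma logistic_slope_lipschitz:
  assumes "\<bar>y\<bar> = 1"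
  shows "\<bar>logistic_slope y s - logistic_slope y t\<bar> \<le> \<bar>s - t\<bar>"
proof -
  have "\<bar>logistic_curvature y r\<bar> \<le> 1" for r
  proof -
    have "exp (y * r) \<le> (1 + exp (y * r))\<^sup>2" by (simp add: power2_sum)
    moreover have "y\<^sup>2 = 1" using assms by (metis abs_square_eq_1 power2_abs power_one)
    ultimately show ?thesis
      using one_plus_exp_pos[of "y * r"] by (simp add: logistic_curvature_def)
  qed
  then show ?thesis
    using field_differentiable_bound[of UNIV "logistic_slope y" "logistic_curvature y" 1 s t]
    by (simp add: logistic_slope_deriv)
qed

lemma logistic_curvature_lower:
  assumes "\<bar>y\<bar> = 1" "\<bar>t\<bar> \<le> M"
  shows "exp (- M) / (1 + exp M)\<^sup>2 \<le> logistic_curvature y t"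
proof -
  have "\<bar>y * t\<bar> \<le> M" using assms by (simp add: abs_mult)
  then have *: "- M \<le> y * t" "y * t \<le> M" by linarith+
  moreover have "y\<^sup>2 = 1" using assms(1) by (metis power2_abs power_one)
  ultimately show ?thesis
    using one_plus_exp_pos[of "y * t"]
    by (auto simp: logistic_curvature_def intro!: frac_le power_mono)
qed

text \<open>The constant is half of the lower bound of the curvature on \<open>{- M..M}\<close>; subtracting \<open>\<lambda>r. \<sigma> * r\<^sup>2\<close>
leaves a convex function, which lies above its tangents.\<close>

lemma logistic_loss_strongly_convex:
  assumes y: "\<bar>y\<bar> = 1" and s: "\<bar>s\<bar> \<le> M" and t: "\<bar>t\<bar> \<le> M"
  defines "\<sigma> \<equiv> exp (- M) / (1 + exp M)\<^sup>2 / 2"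
  shows "logistic_loss y s + logistic_slope y s * (t - s) + \<sigma> * (t - s)\<^sup>2 \<le> logistic_loss y t"
proof -
  have "(logistic_slope y s - 2 * \<sigma> * s) * (t - s)
      \<le> (logistic_loss y t - \<sigma> * t\<^sup>2) - (logistic_loss y s - \<sigma> * s\<^sup>2)"
  proof (rule f''_imp_f'[where C = "{- M..M}" and f'' = "\<lambda>r. logistic_curvature y r - 2 * \<sigma>"])
    show "((\<lambda>r. logistic_loss y r - \<sigma> * r\<^sup>2) has_real_derivative
        logistic_slope y r - 2 * \<sigma> * r) (at r)" for r
      by (auto intro!: derivative_eq_intros logistic_loss_deriv)
    show "((\<lambda>r. logistic_slope y r - 2 * \<sigma> * r) has_real_derivative
        logistic_curvature y r - 2 * \<sigma>) (at r)" for r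
      by (auto intro!: derivative_eq_intros logistic_slope_deriv)
    show "0 \<le> logistic_curvature y r - 2 * \<sigma>" if "r \<in> {- M..M}" for r
      using logistic_curvature_lower[OF y, of r M] that by (auto simp: \<sigma>_def)
  qed (use s t in auto)
  then show ?thesis by (simp add: power2_eq_square algebra_simps)
qed

lemma logistic_l1_composite:
  fixes y :: "'n::finite \<Rightarrow> real" and X :: "real ^ 'p::finite ^ 'n"
  assumes "lam > 0" and y: "\<And>i. \<bar>y i\<bar> = 1" and "\<And>k. column k X \<noteq> 0"
  shows "l1_composite (\<lambda>t. \<Sum>i\<in>UNIV. logistic_loss (y i) (t $ i))
    (\<lambda>t. \<chi> i. logistic_slope (y i) (t $ i)) X lam 1"
proof
  fix t :: "real ^ 'n"
  show "0 \<le> (\<Sum>i\<in>UNIV. logistic_loss (y i) (t $ i))"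
    by (intro sum_nonneg) (simp add: logistic_loss_def)
next
  fix M :: real
  define \<sigma> where "\<sigma> = exp (- M) / (1 + exp M)\<^sup>2 / 2"
  have "(\<Sum>i\<in>UNIV. logistic_loss (y i) (s $ i)) + (\<chi> i. logistic_slope (y i) (s $ i)) \<bullet> (t - s)
      + \<sigma> * (norm (t - s))\<^sup>2 \<le> (\<Sum>i\<in>UNIV. logistic_loss (y i) (t $ i))"
    if "norm s \<le> M" "norm t \<le> M" for s t :: "real ^ 'n"
  proof -
    have "\<bar>s $ i\<bar> \<le> M" "\<bar>t $ i\<bar> \<le> M" for i
      using that component_le_norm_cart order_trans by blast+
    then have "(\<Sum>i\<in>UNIV. logistic_loss (y i) (s $ i) + logistic_slope (y i) (s $ i) * (t $ i - s $ i)
        + \<sigma> * (t $ i - s $ i)\<^sup>2) \<le> (\<Sum>i\<in>UNIV. logistic_loss (y i) (t $ i))"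
      unfolding \<sigma>_def by (intro sum_mono logistic_loss_strongly_convex y)
    then show ?thesis
      unfolding power2_norm_eq_inner
      by (simp add: inner_vec_def sum.distrib sum_distrib_left power2_eq_square)
  qed
  moreover have "\<sigma> > 0" by (simp add: \<sigma>_def one_plus_exp_pos)
  ultimately show "\<exists>\<sigma>>0. \<forall>s t. norm s \<le> M \<longrightarrow> norm t \<le> M \<longrightarrow>
      (\<Sum>i\<in>UNIV. logistic_loss (y i) (s $ i)) + (\<chi> i. logistic_slope (y i) (s $ i)) \<bullet> (t - s)
      + \<sigma> * (norm (t - s))\<^sup>2 \<le> (\<Sum>i\<in>UNIV. logistic_loss (y i) (t $ i))" by blast
next
  fix s t :: "real ^ 'n"
  show "norm ((\<chi> i. logistic_slope (y i) (s $ i)) - (\<chi> i. logistic_slope (y i) (t $ i)))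
      \<le> 1 * norm (s - t)"
    using logistic_slope_lipschitz[OF y] by (auto intro!: norm_le_componentwise_cart)
qed (use assms in auto)

section \<open>Cyclic coordinatewise minimization\<close>

lemma bij_betw_coord: "bij_betw (coord :: nat \<Rightarrow> 'p::{finite,linorder}) {1..CARD('p)} UNIV"
proof -
  let ?xs = "sorted_list_of_set (UNIV :: 'p set)"
  have "bij_betw ((!) ?xs) {..<CARD('p)} UNIV"
    by (rule bij_betw_nth) auto
  moreover have "bij_betw (\<lambda>j. j - 1) {1..CARD('p)} {..<CARD('p)}"
    by (rule bij_betwI[where g = Suc]) auto
  ultimately have "bij_betw ((!) ?xs \<circ> (\<lambda>j. j - 1)) {1..CARD('p)} UNIV"
    by (rule bij_betw_trans[rotated])
  then show ?thesis by (simp add: comp_def coord_def[abs_def])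
qed

theorem theorem5p2:
  fixes lam :: real
    and y :: "'n::finite \<Rightarrow> real"
    and z :: "'n \<Rightarrow> real ^ ('p::{finite,linorder})"
    and \<beta> :: "nat \<Rightarrow> real ^ ('p::{finite,linorder})"
  assumes "lam > 0"
    and "\<And>i. y i \<in> {-1, 1}"
    and "\<And>j. column j (design_matrix z) \<noteq> 0"
    and "ccm_iterates (Q_logit lam y z) \<beta>"
  shows "convergent \<beta>"
proof -
  have y: "\<bar>y i\<bar> = 1" for i using assms(2)[of i] by auto
  interpret l1_composite "\<lambda>t. \<Sum>i\<in>UNIV. logistic_loss (y i) (t $ i)"
    "\<lambda>t. \<chi> i. logistic_slope (y i) (t $ i)" "design_matrix z" lam 1
    by (rule logistic_l1_composite[OF assms(1) y assms(3)])
  have "(design_matrix z *v v) $ i = v \<bullet> z i" for v i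
    by (simp add: design_matrix_def matrix_vector_mult_def inner_vec_def mult.commute)
  then have Q: "Q_logit lam y z = F"
    unfolding F_def[abs_def] unfolding Q_logit_def[abs_def] logistic_loss_def by simp
  obtain b where "\<forall>r. b r 0 = \<beta> r \<and>
      (\<forall>j\<in>{1..CARD('p)}.
        is_arg_min F (\<lambda>v. \<forall>l. l \<noteq> coord j \<longrightarrow> v $ l = b r (j - 1) $ l) (b r j)) \<and>
      \<beta> (Suc r) = b r CARD('p)"
    using assms(4) unfolding ccm_iterates_def Q by (elim exE)
  then have b: "b r 0 = \<beta> r" "\<beta> (Suc r) = b r CARD('p)"
    "\<forall>j\<in>{1..CARD('p)}. is_arg_min F (\<lambda>v. \<forall>l. l \<noteq> coord j \<longrightarrow> v $ l = b r (j - 1) $ l) (b r j)"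
    for r by blast+
  obtain \<kappa> where \<kappa>: "\<kappa> > 0"
    and "\<forall>(e :: nat \<Rightarrow> 'p) m b. bij_betw e {1..m} UNIV \<longrightarrow> F (b 0) \<le> F (\<beta> 0) \<longrightarrow>
      (\<forall>j\<in>{1..m}. is_arg_min F (\<lambda>v. \<forall>l. l \<noteq> e j \<longrightarrow> v $ l = b (j - 1) $ l) (b j)) \<longrightarrow>
      \<kappa> * (norm (b m - b 0))\<^sup>2 \<le> F (b 0) - F (b m) \<and> nearly_stationary (norm (b m - b 0)) (b m)"
    using cyclic_sweep[of "F (\<beta> 0)"] by (elim exE conjE)
  note sw = this(2)[rule_format, OF bij_betw_coord]
  have sweep: "\<kappa> * (norm (\<beta> (Suc r) - \<beta> r))\<^sup>2 \<le> F (\<beta> r) - F (\<beta> (Suc r))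
      \<and> nearly_stationary (norm (\<beta> (Suc r) - \<beta> r)) (\<beta> (Suc r))" if "F (\<beta> r) \<le> F (\<beta> 0)" for r
    using sw[of "b r"] that b(3)[of r] unfolding b(1,2) by blast
  \<comment> \<open>The constant \<open>\<kappa>\<close> belongs to the sublevel set of the starting point, which the iterates never leave.\<close>
  have level: "F (\<beta> r) \<le> F (\<beta> 0)" for r
  proof (induction r)
    case (Suc r)
    have "0 \<le> \<kappa> * (norm (\<beta> (Suc r) - \<beta> r))\<^sup>2" using \<kappa> by simp
    with sweep[OF Suc] Suc show ?case by linarith
  qed simp
  show ?thesis
    by (rule sweeps_converge[OF \<kappa>]) (use sweep[OF level] in auto)
qed

end
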